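(* The robust counterpart $$\max \sum_{j\in J} c_j x_j \quad \text{s.t.}\quad \sum_{j\in J}\bar a_{ij}x_j + DEV_i(x,\mathcal{S}_M)\le b_i\ (i\in I),\quad x_j\ge 0\ (j\in J)$$ of the linear program (LPP) under the multi-band uncertainty set $\mathcal{S}_M$ is equivalent to the following compact linear program (RLP) in the variables $x=(x_j)_{j \in J}$, $v=(v_i^k)_{i \in I, k \in K}$, $w=(w_i^k)_{i \in I, k \in K}$, $z=(z_i^j)_{i \in I, j \in J}$: $$\begin{array}{lll} \max & \displaystyle\sum_{j\in J} c_j x_j & \\ \text{s.t.} & \displaystyle\sum_{j\in J}\bar a_{ij}x_j-\sum_{k\in K} l_k v_i^k+\sum_{k\in K}u_k w_i^k+\sum_{j\in J} z_i^j\le b_i & i\in I\\ & -v_i^k+w_i^k+z_i^j\ge d_{ij}^k x_j & i\in I,\ j\in J,\ k\in K\\ & v_i^k,\ w_i^k\ge 0 & i\in I,\ k\in K\\ & z_i^j\ge 0 & i\in I,\ j\in J\\ & x_j\ge 0 & j\in J. \end{array}$$ Here "equivalent" means that a vector $x\in\mathbb{R}^n$ is feasible for the robust counterpart if and only if there exist $v,w,z$ such that $(x,v,w,z)$ is feasible for (RLP) (the two problems having the same objective function), and "compact" means that the number of variables and constraints of (RLP) is polynomial in $m$, $n$ and $|K|$.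
   Context: Let $I=\{1,\ldots,m\}$, $J=\{1,\ldots,n\}$. (LPP) is the linear program $\max\sum_{j\in J}c_jx_j$ s.t. $\sum_{j\in J}a_{ij}x_j\le b_i$ ($i\in I$), $x_j\ge0$ ($j\in J$), with real data, in which the coefficients $a_{ij}$ are uncertain. Multi-band uncertainty set $\mathcal{S}_M$: each $a_{ij}$ equals a nominal value $\bar a_{ij}\in\mathbb{R}$ plus a deviation. Let $K=\{K^-,\ldots,-1,0,1,\ldots,K^+\}$ (integers $K^-<0<K^+$) be the set of deviation bands. For each $i\in I,j\in J$, real deviation values $$-\infty<d_{ij}^{K^-}<\cdots<d_{ij}^{-1}<d_{ij}^{0}=0<d_{ij}^{1}<\cdots<d_{ij}^{K^+}<+\infty$$ are given; band $k\ne K^-$ corresponds to deviations in $(d_{ij}^{k-1},d_{ij}^k]$, and band $K^-$ to the single value $d_{ij}^{K^-}$. For each band $k\in K$ there are integers $l_k,u_k$ with $0\le l_k\le u_k\le n$, which are a lower and an upper bound on the number of coefficients of a constraint whose deviation falls in band $k$ (the same for every constraint $i$). It is assumed that $u_0=n$ and $\sum_{k\in K}l_k\le n$. For $x\ge0$ and $i\in I$, the maximum overall deviation $DEV_i(x,\mathcal{S}_M)$ allowed by the uncertainty set for $x$ in constraint $i$ is the optimal value of the 0-1 program $$\max\sum_{j\in J}\sum_{k\in K}d_{ij}^k\,x_j\,y_{ij}^k\quad\text{s.t.}\quad l_k\le\sum_{j\in J}y_{ij}^k\le u_k\ (k\in K),\quad \sum_{k\in K}y_{ij}^k\le1\ (j\in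 J),\quad y_{ij}^k\in\{0,1\}\ (j\in J,k\in K).$$ *)

theory Defs
  imports Complex_Main
begin

subsection \<open>Linear programs in inequality form\<close>

text \<open>Maximise \<open>\<Sum>s. obj s * y s\<close> subject to \<open>\<Sum>s. mat r s * y s \<le> bnd r\<close> for every constraint \<open>r\<close>.
  Variables carry no implicit sign restriction: nonnegativity conditions are constraints and
  are counted as such.\<close>

record ('s, 'r) lp =
  lp_vars :: "'s set"
  lp_cons :: "'r set"
  lp_obj :: "'s \<Rightarrow> real"
  lp_mat :: "'r \<Rightarrow> 's \<Rightarrow> real"
  lp_bnd :: "'r \<Rightarrow> real"

definition lp_feasible :: "('s, 'r) lp \<Rightarrow> ('s \<Rightarrow> real) \<Rightarrow> bool" where
  "lp_feasible P y \<longleftrightarrow> (\<forall>r\<in>lp_cons P. (\<Sum>s\<in>lp_vars P. lp_mat P r s * y s) \<le> lp_bnd P r)"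

definition lp_objective :: "('s, 'r) lp \<Rightarrow> ('s \<Rightarrow> real) \<Rightarrow> real" where
  "lp_objective P y = (\<Sum>s\<in>lp_vars P. lp_obj P s * y s)"


subsection \<open>Multi-band instances\<close>

text \<open>Vectors and matrices are functions of which only the values at indices in
  \<open>Iset\<close>, \<open>Jset\<close>, \<open>Kset\<close> matter. \<open>num_rows\<close>, \<open>num_cols\<close> are \<open>m\<close>, \<open>n\<close>;
  \<open>dev D i j k\<close> is \<open>d\<^sub>i\<^sub>j\<^sup>k\<close>, and \<open>lo\<close>, \<open>up\<close> are the bounds \<open>l\<^sub>k\<close>, \<open>u\<^sub>k\<close>.\<close>

record multiband =
  num_rows :: nat
  num_cols :: nat
  cost :: "nat \<Rightarrow> real"
  abar :: "nat \<Rightarrow> nat \<Rightarrow> real"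
  rhs :: "nat \<Rightarrow> real"
  kmin :: int
  kmax :: int
  dev :: "nat \<Rightarrow> nat \<Rightarrow> int \<Rightarrow> real"
  lo :: "int \<Rightarrow> nat"
  up :: "int \<Rightarrow> nat"

definition Iset :: "multiband \<Rightarrow> nat set" where
  "Iset D = {1..num_rows D}"

definition Jset :: "multiband \<Rightarrow> nat set" where
  "Jset D = {1..num_cols D}"

definition Kset :: "multiband \<Rightarrow> int set" where
  "Kset D = {kmin D..kmax D}"

definition valid_multiband :: "multiband \<Rightarrow> bool" where
  "valid_multiband D \<longleftrightarrow>
     kmin D < 0 \<and> 0 < kmax D \<and>
     (\<forall>i\<in>Iset D. \<forall>j\<in>Jset D. strict_mono_on (Kset D) (dev D i j) \<and> dev D i j 0 = 0) \<and>
     (\<forall>k\<in>Kset D. lo D k \<le> up D k \<and> up D k \<le> num_cols D) \<and>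
     up D 0 = num_cols D \<and>
     (\<Sum>k\<in>Kset D. lo D k) \<le> num_cols D"


subsection \<open>Maximum deviation and robust counterpart\<close>

text \<open>The constraints of the 0-1 program do not depend on the row \<open>i\<close>; only its objective does.\<close>

definition band_assignment :: "multiband \<Rightarrow> (nat \<Rightarrow> int \<Rightarrow> nat) \<Rightarrow> bool" where
  "band_assignment D y \<longleftrightarrow>
     (\<forall>k\<in>Kset D. lo D k \<le> (\<Sum>j\<in>Jset D. y j k) \<and> (\<Sum>j\<in>Jset D. y j k) \<le> up D k) \<and>
     (\<forall>j\<in>Jset D. (\<Sum>k\<in>Kset D. y j k) \<le> 1) \<and>
     (\<forall>j\<in>Jset D. \<forall>k\<in>Kset D. y j k \<in> {0, 1})"

text \<open>The set of objective values is finite, because only the values of \<open>y\<close> on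
  \<open>Jset D \<times> Kset D\<close> enter, and it is nonempty for valid instances because
  \<open>\<Sum>k. l\<^sub>k \<le> n\<close>. So \<open>Max\<close> is meaningful.\<close>

definition DEV :: "multiband \<Rightarrow> nat \<Rightarrow> (nat \<Rightarrow> real) \<Rightarrow> real" where
  "DEV D i x = Max {\<Sum>j\<in>Jset D. \<Sum>k\<in>Kset D. dev D i j k * x j * real (y j k) | y. band_assignment D y}"

definition rc_feasible :: "multiband \<Rightarrow> (nat \<Rightarrow> real) \<Rightarrow> bool" where
  "rc_feasible D x \<longleftrightarrow>
     (\<forall>i\<in>Iset D. (\<Sum>j\<in>Jset D. abar D i j * x j) + DEV D i x \<le> rhs D i) \<and>
     (\<forall>j\<in>Jset D. 0 \<le> x j)"

definition rc_objective :: "multiband \<Rightarrow> (nat \<Rightarrow> real) \<Rightarrow> real" where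
  "rc_objective D x = (\<Sum>j\<in>Jset D. cost D j * x j)"


subsection \<open>The linear program (RLP)\<close>

datatype rlp_var =
    VarX nat
  | VarV nat int
  | VarW nat int
  | VarZ nat nat

datatype rlp_con =
    Row nat
  | Band nat nat int
  | NonnegV nat int
  | NonnegW nat int
  | NonnegZ nat nat
  | NonnegX nat

definition rlp_vars :: "multiband \<Rightarrow> rlp_var set" where
  "rlp_vars D =
     {VarX j | j. j \<in> Jset D} \<union>
     {VarV i k | i k. i \<in> Iset D \<and> k \<in> Kset D} \<union>
     {VarW i k | i k. i \<in> Iset D \<and> k \<in> Kset D} \<union>
     {VarZ i j | i j. i \<in> Iset D \<and> j \<in> Jset D}"

definition rlp_cons :: "multiband \<Rightarrow> rlp_con set" where
  "rlp_cons D =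
     {Row i | i. i \<in> Iset D} \<union>
     {Band i j k | i j k. i \<in> Iset D \<and> j \<in> Jset D \<and> k \<in> Kset D} \<union>
     {NonnegV i k | i k. i \<in> Iset D \<and> k \<in> Kset D} \<union>
     {NonnegW i k | i k. i \<in> Iset D \<and> k \<in> Kset D} \<union>
     {NonnegZ i j | i j. i \<in> Iset D \<and> j \<in> Jset D} \<union>
     {NonnegX j | j. j \<in> Jset D}"

fun rlp_mat :: "multiband \<Rightarrow> rlp_con \<Rightarrow> rlp_var \<Rightarrow> real" where
  "rlp_mat D (Row i) s = (case s of
       VarX j \<Rightarrow> abar D i j
     | VarV i' k \<Rightarrow> if i' = i then - real (lo D k) else 0
     | VarW i' k \<Rightarrow> if i' = i then real (up D k) else 0
     | VarZ i' j \<Rightarrow> if i' = i then 1 else 0)"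
| "rlp_mat D (Band i j k) s =
     (if s = VarX j then dev D i j k
      else if s = VarV i k then 1
      else if s = VarW i k then - 1
      else if s = VarZ i j then - 1
      else 0)"
| "rlp_mat D (NonnegV i k) s = (if s = VarV i k then - 1 else 0)"
| "rlp_mat D (NonnegW i k) s = (if s = VarW i k then - 1 else 0)"
| "rlp_mat D (NonnegZ i j) s = (if s = VarZ i j then - 1 else 0)"
| "rlp_mat D (NonnegX j) s = (if s = VarX j then - 1 else 0)"

definition rlp :: "multiband \<Rightarrow> (rlp_var, rlp_con) lp" where
  "rlp D = \<lparr>
     lp_vars = rlp_vars D,
     lp_cons = rlp_cons D,
     lp_obj = (\<lambda>s. case s of VarX j \<Rightarrow> cost D j | _ \<Rightarrow> 0),
     lp_mat = rlp_mat D,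
     lp_bnd = (\<lambda>r. case r of Row i \<Rightarrow> rhs D i | _ \<Rightarrow> 0)\<rparr>"

fun rlp_point :: "(nat \<Rightarrow> real) \<Rightarrow> (nat \<Rightarrow> int \<Rightarrow> real) \<Rightarrow> (nat \<Rightarrow> int \<Rightarrow> real) \<Rightarrow>
    (nat \<Rightarrow> nat \<Rightarrow> real) \<Rightarrow> rlp_var \<Rightarrow> real" where
  "rlp_point x v w z (VarX j) = x j"
| "rlp_point x v w z (VarV i k) = v i k"
| "rlp_point x v w z (VarW i k) = w i k"
| "rlp_point x v w z (VarZ i j) = z i j"

lemma finite_index_sets [simp]: "finite (Iset D)" "finite (Jset D)" "finite (Kset D)"
  by (simp_all add: Iset_def Jset_def Kset_def)

lemma rlp_vars_image:
  "rlp_vars D =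
     (VarX ` Jset D \<union> case_prod VarV ` (Iset D \<times> Kset D)) \<union>
     (case_prod VarW ` (Iset D \<times> Kset D) \<union> case_prod VarZ ` (Iset D \<times> Jset D))"
  by (auto simp: rlp_vars_def)

lemma finite_rlp_vars [simp]: "finite (rlp_vars D)"
  by (simp add: rlp_vars_image)

lemma rlp_vars_iff [simp]:
  "VarX j \<in> rlp_vars D \<longleftrightarrow> j \<in> Jset D"
  "VarV i k \<in> rlp_vars D \<longleftrightarrow> i \<in> Iset D \<and> k \<in> Kset D"
  "VarW i k \<in> rlp_vars D \<longleftrightarrow> i \<in> Iset D \<and> k \<in> Kset D"
  "VarZ i j \<in> rlp_vars D \<longleftrightarrow> i \<in> Iset D \<and> j \<in> Jset D"
  by (auto simp: rlp_vars_def)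

lemma sum_rlp_vars:
  fixes f :: "rlp_var \<Rightarrow> real"
  shows "sum f (rlp_vars D) =
     (\<Sum>j\<in>Jset D. f (VarX j)) + (\<Sum>i\<in>Iset D. \<Sum>k\<in>Kset D. f (VarV i k)) +
     (\<Sum>i\<in>Iset D. \<Sum>k\<in>Kset D. f (VarW i k)) + (\<Sum>i\<in>Iset D. \<Sum>j\<in>Jset D. f (VarZ i j))"
proof -
  have inj: "inj_on VarX (Jset D)" "inj_on (case_prod VarV) (Iset D \<times> Kset D)"
    "inj_on (case_prod VarW) (Iset D \<times> Kset D)" "inj_on (case_prod VarZ) (Iset D \<times> Jset D)"
    by (auto simp: inj_on_def)
  show ?thesis
    unfolding rlp_vars_image
    by (subst sum.union_disjoint; (auto; fail)?)+
      (simp add: sum.reindex inj sum.cartesian_product o_def, simp add: case_prod_unfold)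
qed

lemma rlp_objective_eq:
  "lp_objective (rlp D) (rlp_point x v w z) = (\<Sum>j\<in>Jset D. cost D j * x j)"
  by (simp add: lp_objective_def rlp_def sum_rlp_vars)

text \<open>The matrix form of (RLP) written out as displayed inequalities.\<close>

lemma rlp_feasible_iff:
  "lp_feasible (rlp D) (rlp_point x v w z) \<longleftrightarrow>
     (\<forall>i\<in>Iset D.
        (\<Sum>j\<in>Jset D. abar D i j * x j) - (\<Sum>k\<in>Kset D. real (lo D k) * v i k)
        + (\<Sum>k\<in>Kset D. real (up D k) * w i k) + (\<Sum>j\<in>Jset D. z i j) \<le> rhs D i) \<and>
     (\<forall>i\<in>Iset D. \<forall>j\<in>Jset D. \<forall>k\<in>Kset D. - v i k + w i k + z i j \<ge> dev D i j k * x j) \<and>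
     (\<forall>i\<in>Iset D. \<forall>k\<in>Kset D. v i k \<ge> 0 \<and> w i k \<ge> 0) \<and>
     (\<forall>i\<in>Iset D. \<forall>j\<in>Jset D. z i j \<ge> 0) \<and>
     (\<forall>j\<in>Jset D. x j \<ge> 0)"
proof -
  let ?y = "rlp_point x v w z"
  let ?S = "\<lambda>r. \<Sum>s\<in>rlp_vars D. rlp_mat D r s * ?y s"
  have delta: "(\<Sum>s\<in>rlp_vars D. (if s = t then c else 0) * ?y s) = c * ?y t"
    if "t \<in> rlp_vars D" for t c
    using that by (simp add: if_distrib[of "\<lambda>a. a * _"] cong: if_cong)
  have row: "?S (Row i) =
        (\<Sum>j\<in>Jset D. abar D i j * x j) - (\<Sum>k\<in>Kset D. real (lo D k) * v i k)
        + (\<Sum>k\<in>Kset D. real (up D k) * w i k) + (\<Sum>j\<in>Jset D. z i j)" if "i \<in> Iset D" for i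
  proof -
    have *: "(\<Sum>i'\<in>Iset D. \<Sum>k\<in>A. (if i' = i then g k else 0) * h i' k) = (\<Sum>k\<in>A. g k * h i k)"
      for A :: "'b set" and g :: "'b \<Rightarrow> real" and h
    proof -
      have "(\<Sum>i'\<in>Iset D. \<Sum>k\<in>A. (if i' = i then g k else 0) * h i' k) =
          (\<Sum>i'\<in>Iset D. if i' = i then \<Sum>k\<in>A. g k * h i k else 0)"
        by (rule sum.cong) auto
      then show ?thesis using that by simp
    qed
    show ?thesis by (simp add: sum_rlp_vars * sum_negf)
  qed
  have band: "?S (Band i j k) = dev D i j k * x j + v i k - w i k - z i j"
    if "i \<in> Iset D" "j \<in> Jset D" "k \<in> Kset D" for i j k
  proof -
    have "rlp_mat D (Band i j k) s =
        (if s = VarX j then dev D i j k else 0) + (if s = VarV i k then 1 else 0) +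
        (if s = VarW i k then - 1 else 0) + (if s = VarZ i j then - 1 else 0)" for s
      by auto
    then have "?S (Band i j k) =
        (\<Sum>s\<in>rlp_vars D. (if s = VarX j then dev D i j k else 0) * ?y s) +
        (\<Sum>s\<in>rlp_vars D. (if s = VarV i k then 1 else 0) * ?y s) +
        (\<Sum>s\<in>rlp_vars D. (if s = VarW i k then - 1 else 0) * ?y s) +
        (\<Sum>s\<in>rlp_vars D. (if s = VarZ i j then - 1 else 0) * ?y s)"
      by (simp only: distrib_right sum.distrib)
    also have "\<dots> = dev D i j k * x j + v i k - w i k - z i j"
      using that by (simp only: delta rlp_vars_iff) simp
    finally show ?thesis .
  qed
  have nonneg:
    "i \<in> Iset D \<Longrightarrow> k \<in> Kset D \<Longrightarrow> ?S (NonnegV i k) = - v i k"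
    "i \<in> Iset D \<Longrightarrow> k \<in> Kset D \<Longrightarrow> ?S (NonnegW i k) = - w i k"
    "i \<in> Iset D \<Longrightarrow> j \<in> Jset D \<Longrightarrow> ?S (NonnegZ i j) = - z i j"
    "j \<in> Jset D \<Longrightarrow> ?S (NonnegX j) = - x j" for i j k
    by (simp_all only: rlp_mat.simps delta rlp_vars_iff) simp_all
  have split: "(\<forall>r\<in>rlp_cons D. P r) \<longleftrightarrow>
      (\<forall>i\<in>Iset D. P (Row i)) \<and>
      (\<forall>i\<in>Iset D. \<forall>j\<in>Jset D. \<forall>k\<in>Kset D. P (Band i j k)) \<and>
      (\<forall>i\<in>Iset D. \<forall>k\<in>Kset D. P (NonnegV i k) \<and> P (NonnegW i k)) \<and>
      (\<forall>i\<in>Iset D. \<forall>j\<in>Jset D. P (NonnegZ i j)) \<and>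
      (\<forall>j\<in>Jset D. P (NonnegX j))" for P
    unfolding rlp_cons_def by blast
  have "lp_feasible (rlp D) ?y \<longleftrightarrow>
      (\<forall>r\<in>rlp_cons D. ?S r \<le> (case r of Row i \<Rightarrow> rhs D i | _ \<Rightarrow> 0))"
    by (simp add: lp_feasible_def rlp_def)
  also have "\<dots> \<longleftrightarrow>
     (\<forall>i\<in>Iset D.
        (\<Sum>j\<in>Jset D. abar D i j * x j) - (\<Sum>k\<in>Kset D. real (lo D k) * v i k)
        + (\<Sum>k\<in>Kset D. real (up D k) * w i k) + (\<Sum>j\<in>Jset D. z i j) \<le> rhs D i) \<and>
     (\<forall>i\<in>Iset D. \<forall>j\<in>Jset D. \<forall>k\<in>Kset D. dev D i j k * x j + v i k - w i k - z i j \<le> 0) \<and>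
     (\<forall>i\<in>Iset D. \<forall>k\<in>Kset D. - v i k \<le> 0 \<and> - w i k \<le> 0) \<and>
     (\<forall>i\<in>Iset D. \<forall>j\<in>Jset D. - z i j \<le> 0) \<and>
     (\<forall>j\<in>Jset D. - x j \<le> 0)"
    unfolding split by (simp only: row band nonneg rlp_con.case cong: ball_cong)
  finally show ?thesis by (simp add: algebra_simps)
qed


subsection \<open>Polynomial size\<close>

definition polynomial3 :: "(nat \<Rightarrow> nat \<Rightarrow> nat \<Rightarrow> nat) \<Rightarrow> bool" where
  "polynomial3 p \<longleftrightarrow>
     (\<exists>N coef. \<forall>a b c. p a b c = (\<Sum>i\<le>N. \<Sum>j\<le>N. \<Sum>k\<le>N. coef i j k * a ^ i * b ^ j * c ^ k))"

end

theory Submission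
  imports Defs "HOL-Library.FuncSet"
begin

text \<open>
  For a fixed row \<open>i\<close> and a fixed \<open>x\<close>, the 0-1 program behind \<open>DEV\<close> assigns each column to at most
  one band, respecting the band sizes. The variables \<open>v\<close>, \<open>w\<close>, \<open>z\<close> of row \<open>i\<close> are the dual variables
  of its linear relaxation, for the lower bounds, the upper bounds and the condition that a column
  lies in at most one band. Hence the equivalence says that the integer optimum equals the minimum of
  the linear dual. Weak duality (\<open>DEV_le_dual_value\<close>) turns a feasible point of (RLP) into a feasible
  point of the robust counterpart; a dual solution of value exactly \<open>DEV\<close> (\<open>DEV_dual_attained\<close>) gives
  the converse. The rows of (RLP) share only \<open>x\<close>, so each row may choose its dual solution
  independently.

  The dual solution is constructed combinatorially. Being unassigned is treated as an extra band \<open>None\<close> of deviation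
  zero and unreachable capacity, so that the 0-1 program optimises over total assignments with
  prescribed bounds on the class sizes. From an optimal assignment \<open>f\<close>, build the exchange graph whose
  nodes are the bands and one slack node: an arc from band \<open>b\<close> to band \<open>c\<close> carries the best gain from
  moving one column from \<open>b\<close> to \<open>c\<close>, and arcs to or from the slack node, of weight zero, say that \<open>b\<close>
  may grow or shrink by one. Moving columns along a cycle keeps the assignment admissible, so by
  optimality no cycle has positive weight. Longest simple paths then define a potential
  (\<open>ex_potential\<close>), and its differences to the slack node are prices \<open>\<rho>\<close> of the bands: every column sits
  in a band of maximal gain minus price, and only bands filled to the upper (lower) bound have positive
  (negative) price (\<open>ex_prices\<close>). The positive and negative parts of the prices are \<open>w\<close> and \<open>v\<close>, and
  \<open>z\<close> is the net gain of a column; complementary slackness makes the dual value equal to \<open>DEV\<close>.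
\<close>


section \<open>Potentials in graphs without positive cycles\<close>

fun walk_weight :: "('v \<Rightarrow> 'v \<Rightarrow> real) \<Rightarrow> 'v list \<Rightarrow> real" where
  "walk_weight w (a # b # xs) = w a b + walk_weight w (b # xs)"
| "walk_weight w _ = 0"

lemma walk_weight_split:
  "walk_weight w (xs @ v # ys) = walk_weight w (xs @ [v]) + walk_weight w (v # ys)"
  by (induction w xs rule: walk_weight.induct) auto

lemma walk_weight_snoc:
  "walk_weight w (v # xs @ [c]) = walk_weight w (v # xs) + w (last (v # xs)) c"
  by (induction xs arbitrary: v) auto

lemma walk_weight_closed:
  "walk_weight w (v # xs @ [c]) = sum_list (map2 w (v # xs) (xs @ [c]))"
  by (induction xs arbitrary: v) auto

lemma successively_closed:
  "successively E (v # xs @ [c]) \<longleftrightarrow> list_all2 E (v # xs) (xs @ [c])"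
  by (induction xs arbitrary: v) auto

lemma ex_map_eq:
  assumes "distinct xs" "length xs = length ys"
  shows "\<exists>\<sigma>. map \<sigma> xs = ys"
  using assms(2,1)
proof (induction xs ys rule: list_induct2)
  case (Cons x xs y ys)
  then obtain \<sigma> where "map \<sigma> xs = ys" by auto
  with Cons.prems show ?case by (intro exI[of _ "\<sigma>(x := y)"]) auto
qed simp

text \<open>
  The potential of a node is the largest weight of a simple path ending there. If the arc \<open>(a, b)\<close> extends
  an optimal path for \<open>a\<close> to a path that is no longer simple, then the extended path closes a simple
  cycle at \<open>b\<close>; that cycle has weight at most zero and can be cut off. Paths may start anywhere, so
  the potential is finite also at nodes that have no incoming arc. Cycles are given as bijections
  because an exchange along a cycle is most easily described by its successor map.
\<close>

lemma ex_potential: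
  fixes w :: "'v \<Rightarrow> 'v \<Rightarrow> real"
  assumes fin: "finite V"
    and cyc: "\<And>C \<sigma>. C \<subseteq> V \<Longrightarrow> bij_betw \<sigma> C C \<Longrightarrow> (\<And>v. v \<in> C \<Longrightarrow> E v (\<sigma> v)) \<Longrightarrow>
                (\<Sum>v\<in>C. w v (\<sigma> v)) \<le> 0"
  shows "\<exists>\<pi>. \<forall>a\<in>V. \<forall>b\<in>V. E a b \<longrightarrow> \<pi> a + w a b \<le> \<pi> b"
proof -
  have cycle: "walk_weight w (v # xs @ [v]) \<le> 0"
    if dist: "distinct (v # xs)" and "set (v # xs) \<subseteq> V" and succ: "successively E (v # xs @ [v])" for v xs
  proof -
    \<comment> \<open>\<open>\<sigma>\<close> sends every node of the cycle to its successor.\<close>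
    obtain \<sigma> where \<sigma>: "map \<sigma> (v # xs) = xs @ [v]"
      using ex_map_eq[OF dist, of "xs @ [v]"] by auto
    let ?C = "set (v # xs)"
    have "distinct (map \<sigma> (v # xs))" "set (map \<sigma> (v # xs)) = ?C"
      using dist unfolding \<sigma> by auto
    then have bij: "bij_betw \<sigma> ?C ?C"
      unfolding bij_betw_def distinct_map set_map by blast
    have "list_all2 E (v # xs) (map \<sigma> (v # xs))"
      using succ unfolding \<sigma> successively_closed .
    then have arcs: "E a (\<sigma> a)" if "a \<in> ?C" for a
      using that by (auto simp: list_all2_conv_all_nth in_set_conv_nth simp del: list.map)
    have "walk_weight w (v # xs @ [v]) = sum_list (map2 w (v # xs) (map \<sigma> (v # xs)))"
      unfolding \<sigma> by (rule walk_weight_closed)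
    also have "\<dots> = sum_list (map (\<lambda>a. w a (\<sigma> a)) (v # xs))"
      by (simp add: map2_map_map[where f = "\<lambda>x. x", simplified])
    also have "\<dots> = (\<Sum>a\<in>?C. w a (\<sigma> a))"
      using dist by (rule sum_list_distinct_conv_sum_set)
    also have "\<dots> \<le> 0"
      using \<open>?C \<subseteq> V\<close> bij arcs by (rule cyc)
    finally show ?thesis .
  qed
  define P where "P v = {xs. distinct xs \<and> set xs \<subseteq> V \<and> successively E xs \<and> xs \<noteq> [] \<and> last xs = v}" for v
  define \<pi> where "\<pi> v = Max (walk_weight w ` P v)" for v
  have finP: "finite (walk_weight w ` P v)" for v
    using finite_subset_distinct[OF fin]
    by (intro finite_imageI) (rule finite_subset[rotated], auto simp: P_def)
  have le: "walk_weight w xs \<le> \<pi> v" if "xs \<in> P v" for xs v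
    unfolding \<pi>_def using that by (intro Max_ge finP) auto
  have "\<pi> a + w a b \<le> \<pi> b" if ab: "a \<in> V" "b \<in> V" "E a b" for a b
  proof -
    have "[a] \<in> P a" using ab by (simp add: P_def)
    then have "\<pi> a \<in> walk_weight w ` P a"
      unfolding \<pi>_def by (intro Max_in finP) auto
    then obtain xs where xs: "xs \<in> P a" "\<pi> a = walk_weight w xs" by blast
    have succ: "successively E (xs @ [b])"
      using xs(1) ab(3) by (auto simp: P_def successively_append_iff)
    have eq: "\<pi> a + w a b = walk_weight w (xs @ [b])"
      using xs by (cases xs) (auto simp: P_def walk_weight_snoc[simplified])
    show ?thesis
    \<comment> \<open>If \<open>b\<close> lies on the path already, its part from \<open>b\<close> on is a cycle together with the new arc.\<close>
    proof (cases "b \<in> set xs")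
      case False
      then have "xs @ [b] \<in> P b"
        using xs(1) ab succ by (auto simp: P_def)
      then show ?thesis unfolding eq by (rule le)
    next
      case True
      then obtain ys zs where split: "xs = ys @ b # zs"
        by (auto dest: split_list)
      have "ys @ [b] \<in> P b"
        using xs(1) succ unfolding split by (auto simp: P_def successively_append_iff)
      moreover have "walk_weight w (b # zs @ [b]) \<le> 0"
        using xs(1) succ unfolding split
        by (intro cycle) (auto simp: P_def successively_append_iff)
      ultimately show ?thesis
        unfolding eq split using le[of "ys @ [b]" b] walk_weight_split[of w ys b "zs @ [b]"] by simp
    qed
  qed
  then show ?thesis by blast
qed

section \<open>Prices supporting an optimal assignment\<close>

definition sized_assignments :: "'a set \<Rightarrow> 'b set \<Rightarrow> ('b \<Rightarrow> nat) \<Rightarrow> ('b \<Rightarrow> nat) \<Rightarrow> ('a \<Rightarrow> 'b) set" where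
  "sized_assignments J B l u =
     {f \<in> J \<rightarrow>\<^sub>E B. \<forall>b\<in>B. l b \<le> card {j \<in> J. f j = b} \<and> card {j \<in> J. f j = b} \<le> u b}"

lemma finite_ex_maximizer:
  fixes q :: "'a \<Rightarrow> real"
  assumes "finite A" "A \<noteq> {}"
  shows "\<exists>a\<in>A. \<forall>j\<in>A. q j \<le> q a"
proof -
  have "Max (q ` A) \<in> q ` A" using assms by simp
  then obtain a where "a \<in> A" "q a = Max (q ` A)" by force
  then show ?thesis using assms by (intro bexI[of _ a]) auto
qed

text \<open>
  Optimality of \<open>f\<close> forbids cycles of positive weight in its exchange graph. The potential inequality on
  an arc between two classes says that no member gains by switching at the prices \<open>\<rho>\<close>; on the arcs at
  the slack node it says that a class which can still grow has price at most zero and one which can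
  still shrink has price at least zero.
\<close>

lemma ex_prices:
  fixes p :: "'a \<Rightarrow> 'b \<Rightarrow> real" and l u :: "'b \<Rightarrow> nat"
  assumes fin: "finite J" "finite B"
    and f: "f \<in> sized_assignments J B l u"
    and opt: "\<And>g. g \<in> sized_assignments J B l u \<Longrightarrow> (\<Sum>j\<in>J. p j (g j)) \<le> (\<Sum>j\<in>J. p j (f j))"
  shows "\<exists>\<rho>. (\<forall>j\<in>J. \<forall>b\<in>B. p j b - \<rho> b \<le> p j (f j) - \<rho> (f j)) \<and>
             (\<forall>b\<in>B. (\<rho> b > 0 \<longrightarrow> card {j \<in> J. f j = b} = u b) \<and>
                     (\<rho> b < 0 \<longrightarrow> card {j \<in> J. f j = b} = l b))"
proof -
  let ?n = "\<lambda>b. card {j \<in> J. f j = b}"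
  have fB: "f j \<in> B" if "j \<in> J" for j
    using f that by (auto simp: sized_assignments_def)
  have bnd: "l b \<le> ?n b" "?n b \<le> u b" if "b \<in> B" for b
    using f that by (auto simp: sized_assignments_def)
  have "\<exists>a. (\<exists>j\<in>J. f j = b) \<longrightarrow> a \<in> J \<and> f a = b \<and> (\<forall>j\<in>J. f j = b \<longrightarrow> p j c - p j b \<le> p a c - p a b)" for b c
    using finite_ex_maximizer[of "{j \<in> J. f j = b}" "\<lambda>j. p j c - p j b"] fin(1) by fastforce
  then obtain r where r: "\<And>b c. \<exists>j\<in>J. f j = b \<Longrightarrow> r b c \<in> J \<and> f (r b c) = b \<and>
      (\<forall>j\<in>J. f j = b \<longrightarrow> p j c - p j b \<le> p (r b c) c - p (r b c) b)"
    by metis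
  \<comment> \<open>The exchange graph on \<open>'b option\<close>: here \<open>None\<close> is the slack node, and \<open>r b c\<close> is the member of
    class \<open>b\<close> that gains most by moving to \<open>c\<close>.\<close>
  define E where "E s t = (case s of
      None \<Rightarrow> (case t of None \<Rightarrow> False | Some b \<Rightarrow> l b < ?n b)
    | Some b \<Rightarrow> (case t of None \<Rightarrow> ?n b < u b | Some c \<Rightarrow> \<exists>j\<in>J. f j = b))" for s t
  define w where "w s t = (case s of None \<Rightarrow> 0
    | Some b \<Rightarrow> (case t of None \<Rightarrow> 0 | Some c \<Rightarrow> p (r b c) c - p (r b c) b))" for s t
  define V where "V = insert None (Some ` B)"
  have "\<exists>\<pi>. \<forall>s\<in>V. \<forall>t\<in>V. E s t \<longrightarrow> \<pi> s + w s t \<le> \<pi> t"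
  proof (rule ex_potential)
    show "finite V" using fin by (simp add: V_def)
  next
    fix C \<sigma>
    assume CV: "C \<subseteq> V" and bij: "bij_betw \<sigma> C C" and arcs: "\<And>s. s \<in> C \<Longrightarrow> E s (\<sigma> s)"
    have \<sigma>C: "\<sigma> s \<in> C" if "s \<in> C" for s
      using bij that by (auto simp: bij_betw_def)
    have inj: "s = t" if "s \<in> C" "t \<in> C" "\<sigma> s = \<sigma> t" for s t
      using bij that by (auto simp: bij_betw_def inj_on_def)
    \<comment> \<open>Every class in \<open>S\<close> sends its best mover \<open>m b\<close> to the next class on \<open>\<sigma>\<close>; a class whose successor
      is the slack node sends nobody.\<close>
    define m where "m b = r b (the (\<sigma> (Some b)))" for b
    define S where "S = {b. Some b \<in> C \<and> \<sigma> (Some b) \<noteq> None}"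
    have SB: "S \<subseteq> B" using CV by (auto simp: S_def V_def)
    have m: "m b \<in> J" "f (m b) = b" if "b \<in> S" for b
    proof -
      have "E (Some b) (\<sigma> (Some b))" "\<sigma> (Some b) \<noteq> None"
        using that arcs by (auto simp: S_def)
      then have "\<exists>j\<in>J. f j = b" by (auto simp: E_def split: option.splits)
      from r[OF this] show "m b \<in> J" "f (m b) = b" by (auto simp: m_def)
    qed
    define g where "g = (\<lambda>j\<in>J. if j \<in> m ` S then the (\<sigma> (Some (f j))) else f j)"
    have gm: "g (m b) = the (\<sigma> (Some b))" if "b \<in> S" for b
      using that m by (simp add: g_def)
    have g_stay: "g j = f j" if "j \<in> J" "j \<notin> m ` S" for j
      using that by (simp add: g_def)
    have out: "{j \<in> J. f j = b} = {j \<in> J - m ` S. f j = b} \<union> m ` (S \<inter> {b})" for b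
      using m by auto
    have into: "{j \<in> J. g j = b} = {j \<in> J - m ` S. f j = b} \<union> m ` {a \<in> S. \<sigma> (Some a) = Some b}" for b
    proof (intro equalityI subsetI)
      fix j assume j: "j \<in> {j \<in> J. g j = b}"
      show "j \<in> {j \<in> J - m ` S. f j = b} \<union> m ` {a \<in> S. \<sigma> (Some a) = Some b}"
      proof (cases "j \<in> m ` S")
        case True
        then obtain a where "a \<in> S" "j = m a" by blast
        then show ?thesis using j gm by (auto simp: S_def)
      qed (use j g_stay in auto)
    qed (use m gm g_stay in auto)
    \<comment> \<open>A class loses at most one member and, as \<open>\<sigma>\<close> is injective, receives at most one.\<close>
    have nf: "?n b = card {j \<in> J - m ` S. f j = b} + of_bool (b \<in> S)" for b
      unfolding out using fin(1) by (subst card_Un_disjoint) auto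
    have ng: "card {j \<in> J. g j = b} = card {j \<in> J - m ` S. f j = b} + of_bool (\<exists>a\<in>S. \<sigma> (Some a) = Some b)" for b
    proof -
      have "{a \<in> S. \<sigma> (Some a) = Some b} = (if \<exists>a\<in>S. \<sigma> (Some a) = Some b
          then {SOME a. a \<in> S \<and> \<sigma> (Some a) = Some b} else {})" (is "?A = _")
      proof (cases "\<exists>a\<in>S. \<sigma> (Some a) = Some b")
        case True
        then obtain a where "a \<in> S" "\<sigma> (Some a) = Some b" by blast
        then have *: "?A = {a}" using inj by (fastforce simp: S_def)
        then have "\<And>c. c \<in> S \<and> \<sigma> (Some c) = Some b \<longleftrightarrow> c = a" by blast
        then show ?thesis using True * by simp
      qed auto
      then have "card (m ` ?A) = of_bool (\<exists>a\<in>S. \<sigma> (Some a) = Some b)" "finite ?A" by simp_all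
      then show ?thesis
        unfolding into using fin(1) by (subst card_Un_disjoint) auto
    qed
    have "g \<in> sized_assignments J B l u"
      unfolding sized_assignments_def
    proof (intro CollectI conjI ballI)
      have "the (\<sigma> (Some b)) \<in> B" if "b \<in> S" for b
        using that \<sigma>C CV by (fastforce simp: S_def V_def)
      then show "g \<in> J \<rightarrow>\<^sub>E B"
        using fB m by (auto simp: g_def)
    next
      fix b assume b: "b \<in> B"
      \<comment> \<open>A class that only shrinks is preceded by the slack node, and one that only grows is followed
        by it, so in both cases the arc guarantees room for the change.\<close>
      show "l b \<le> card {j \<in> J. g j = b}"
      proof (cases "b \<in> S \<and> \<not> (\<exists>a\<in>S. \<sigma> (Some a) = Some b)")
        case True
        then have "Some b \<in> C" by (simp add: S_def)
        then obtain s where s: "s \<in> C" "\<sigma> s = Some b"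
          using bij unfolding bij_betw_def by (metis imageE)
        with True have "s = None" by (cases s) (auto simp: S_def)
        then have "l b < ?n b" using arcs[OF s(1)] s(2) by (simp add: E_def)
        then show ?thesis using nf[of b] ng[of b] True by simp
      next
        case False
        then show ?thesis using nf[of b] ng[of b] bnd[OF b] by (auto simp: of_bool_def split: if_splits)
      qed
      show "card {j \<in> J. g j = b} \<le> u b"
      proof (cases "b \<notin> S \<and> (\<exists>a\<in>S. \<sigma> (Some a) = Some b)")
        case True
        then have C: "Some b \<in> C" using \<sigma>C by (force simp: S_def)
        with True have "\<sigma> (Some b) = None" by (simp add: S_def)
        then have "?n b < u b" using arcs[OF C] by (simp add: E_def)
        then show ?thesis using nf[of b] ng[of b] True by simp
      next
        case False
        then show ?thesis using nf[of b] ng[of b] bnd[OF b] by (auto simp: of_bool_def split: if_splits)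
      qed
    qed
    then have "(\<Sum>j\<in>J. p j (g j)) \<le> (\<Sum>j\<in>J. p j (f j))" by (rule opt)
    moreover have "(\<Sum>j\<in>J. p j (g j) - p j (f j)) = (\<Sum>j\<in>m ` S. p j (g j) - p j (f j))"
      using fin(1) m g_stay by (intro sum.mono_neutral_right) auto
    moreover have "\<dots> = (\<Sum>b\<in>S. p (m b) (g (m b)) - p (m b) (f (m b)))"
      using m by (subst sum.reindex) (auto simp: o_def intro: inj_on_inverseI[of _ f])
    moreover have "\<dots> = (\<Sum>b\<in>S. w (Some b) (\<sigma> (Some b)))"
      using m gm by (intro sum.cong) (auto simp: w_def m_def S_def)
    moreover have "\<dots> = (\<Sum>s\<in>Some ` S. w s (\<sigma> s))"
      by (subst sum.reindex) auto
    moreover have "\<dots> = (\<Sum>s\<in>C. w s (\<sigma> s))"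
    proof (rule sum.mono_neutral_left)
      show "finite C" using CV fin(2) by (auto simp: V_def intro: finite_subset)
      show "Some ` S \<subseteq> C" by (auto simp: S_def)
      show "\<forall>s\<in>C - Some ` S. w s (\<sigma> s) = 0"
        by (auto simp: S_def w_def image_iff split: option.splits)
    qed
    ultimately show "(\<Sum>s\<in>C. w s (\<sigma> s)) \<le> 0" by (simp add: sum_subtractf)
  qed
  then obtain \<pi> where \<pi>: "\<And>s t. s \<in> V \<Longrightarrow> t \<in> V \<Longrightarrow> E s t \<Longrightarrow> \<pi> s + w s t \<le> \<pi> t"
    by blast
  define \<rho> where "\<rho> b = \<pi> (Some b) - \<pi> None" for b
  have "p j b - \<rho> b \<le> p j (f j) - \<rho> (f j)" if "j \<in> J" "b \<in> B" for j b
  proof -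
    have "\<pi> (Some (f j)) + w (Some (f j)) (Some b) \<le> \<pi> (Some b)"
      using that fB by (intro \<pi>) (auto simp: V_def E_def)
    moreover have "p j b - p j (f j) \<le> w (Some (f j)) (Some b)"
      using r[of "f j" b] that by (auto simp: w_def)
    ultimately show ?thesis by (simp add: \<rho>_def)
  qed
  moreover have "?n b = u b" if "b \<in> B" "\<rho> b > 0" for b
    using \<pi>[of "Some b" None] that bnd[of b] by (fastforce simp: V_def E_def w_def \<rho>_def)
  moreover have "?n b = l b" if "b \<in> B" "\<rho> b < 0" for b
    using \<pi>[of None "Some b"] that bnd[of b] by (fastforce simp: V_def E_def w_def \<rho>_def)
  ultimately show ?thesis by blast
qed

section \<open>The maximum deviation as an optimal assignment\<close>

lemma ex_exact_partial_assignment: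
  assumes "finite K" "finite J" "(\<Sum>k\<in>K. l k) \<le> card J"
  shows "\<exists>g \<in> J \<rightarrow>\<^sub>E insert None (Some ` K). \<forall>k\<in>K. card {j \<in> J. g j = Some k} = l k"
  using assms
proof (induction K arbitrary: J rule: finite_induct)
  case empty
  then show ?case by (intro bexI[of _ "\<lambda>j\<in>J. None"]) auto
next
  case (insert k K)
  then have le: "l k + (\<Sum>k\<in>K. l k) \<le> card J" by simp
  then obtain S where S: "S \<subseteq> J" "card S = l k"
    using obtain_subset_with_card_n[of "l k" J] by auto
  then have "card (J - S) = card J - l k"
    using insert.prems(1) by (simp add: card_Diff_subset finite_subset)
  then have "\<exists>g \<in> J - S \<rightarrow>\<^sub>E insert None (Some ` K). \<forall>c\<in>K. card {j \<in> J - S. g j = Some c} = l c"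
    using le insert.prems(1) by (intro insert.IH) auto
  then obtain g where g: "g \<in> J - S \<rightarrow>\<^sub>E insert None (Some ` K)"
      "\<And>c. c \<in> K \<Longrightarrow> card {j \<in> J - S. g j = Some c} = l c"
    by blast
  define h where "h = (\<lambda>j\<in>J. if j \<in> S then Some k else g j)"
  have gK: "g j \<noteq> Some k" if "j \<in> J - S" for j
    using g(1) that insert.hyps(2) by (force simp: PiE_iff)
  have "{j \<in> J. h j = Some k} = S"
    using S gK by (auto simp: h_def)
  moreover have "{j \<in> J. h j = Some c} = {j \<in> J - S. g j = Some c}" if "c \<in> K" for c
    using that insert.hyps(2) by (auto simp: h_def)
  moreover have "h \<in> J \<rightarrow>\<^sub>E insert None (Some ` insert k K)"
    using g(1) by (force simp: h_def PiE_iff)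
  ultimately show ?case
    using S g(2) by (intro bexI[of _ h]) auto
qed

text \<open>
  The value \<open>None\<close> marks an unassigned column. Its class must be unrestricted, and the capacity is one more
  than the number of columns so that it can never be exhausted: this forces the price of \<open>None\<close> to be
  at most zero, which is what makes \<open>z\<close> nonnegative.
\<close>

definition band_choices :: "multiband \<Rightarrow> (nat \<Rightarrow> int option) set" where
  "band_choices D = sized_assignments (Jset D) (insert None (Some ` Kset D))
     (case_option 0 (lo D)) (case_option (Suc (num_cols D)) (up D))"

definition gain :: "multiband \<Rightarrow> nat \<Rightarrow> (nat \<Rightarrow> real) \<Rightarrow> nat \<Rightarrow> int option \<Rightarrow> real" where
  "gain D i x j b = (case b of None \<Rightarrow> 0 | Some k \<Rightarrow> dev D i j k * x j)"

lemma card_Jset [simp]: "card (Jset D) = num_cols D"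
  by (simp add: Jset_def)

lemma card_filter_Jset_le: "card {j \<in> Jset D. P j} \<le> num_cols D"
  using card_mono[of "Jset D" "{j \<in> Jset D. P j}"] by auto

lemma band_choices_iff:
  "f \<in> band_choices D \<longleftrightarrow> f \<in> Jset D \<rightarrow>\<^sub>E insert None (Some ` Kset D) \<and>
     (\<forall>k\<in>Kset D. lo D k \<le> card {j \<in> Jset D. f j = Some k} \<and>
                  card {j \<in> Jset D. f j = Some k} \<le> up D k)"
  by (auto simp: band_choices_def sized_assignments_def intro!: le_SucI card_filter_Jset_le)

lemma finite_band_choices: "finite (band_choices D)"
  by (rule finite_subset[of _ "Jset D \<rightarrow>\<^sub>E insert None (Some ` Kset D)"])
    (auto simp: band_choices_iff intro!: finite_PiE)

lemma band_choices_nonempty: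
  assumes "valid_multiband D"
  shows "band_choices D \<noteq> {}"
proof -
  have "(\<Sum>k\<in>Kset D. lo D k) \<le> card (Jset D)"
    using assms by (simp add: valid_multiband_def)
  then obtain g where "g \<in> Jset D \<rightarrow>\<^sub>E insert None (Some ` Kset D)"
      "\<forall>k\<in>Kset D. card {j \<in> Jset D. g j = Some k} = lo D k"
    using ex_exact_partial_assignment[of "Kset D" "Jset D" "lo D"] by auto
  then have "g \<in> band_choices D"
    using assms by (auto simp: band_choices_iff valid_multiband_def)
  then show ?thesis by blast
qed

lemma sum_indicator_option:
  fixes c :: "'k \<Rightarrow> 'c::semiring_1"
  assumes "finite K" "b \<in> insert None (Some ` K)"
  shows "(\<Sum>k\<in>K. c k * of_bool (b = Some k)) = (case b of None \<Rightarrow> 0 | Some k \<Rightarrow> c k)"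
  using assms by (cases b) (auto simp: of_bool_def if_distrib cong: if_cong)

text \<open>
  A 0-1 matrix with row sums at most one is the same as a partial function, and its column sums are the
  class sizes. This translation removes the 0-1 program from the rest of the argument.
\<close>

lemma assignment_values:
  "{\<Sum>j\<in>Jset D. \<Sum>k\<in>Kset D. dev D i j k * x j * real (y j k) | y. band_assignment D y} =
     (\<lambda>f. \<Sum>j\<in>Jset D. gain D i x j (f j)) ` band_choices D"  (is "{?val y | y. _} = ?R")
proof -
  have encode: "band_assignment D y \<longleftrightarrow> f \<in> band_choices D" (is ?A)
    and val: "?val y = (\<Sum>j\<in>Jset D. gain D i x j (f j))" (is ?B)
    if f: "f \<in> Jset D \<rightarrow>\<^sub>E insert None (Some ` Kset D)"
      and y: "\<And>j k. j \<in> Jset D \<Longrightarrow> k \<in> Kset D \<Longrightarrow> y j k = of_bool (f j = Some k)" for y f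
  proof -
    have fj: "f j \<in> insert None (Some ` Kset D)" if "j \<in> Jset D" for j
      using f that by blast
    have col: "(\<Sum>j\<in>Jset D. y j k) = card {j \<in> Jset D. f j = Some k}" if "k \<in> Kset D" for k
      using that y by (simp add: of_bool_def sum.If_cases Int_def cong: sum.cong)
    have row: "(\<Sum>k\<in>Kset D. y j k) \<le> 1" if "j \<in> Jset D" for j
    proof -
      have "(\<Sum>k\<in>Kset D. y j k) = (\<Sum>k\<in>Kset D. 1 * of_bool (f j = Some k))"
        using that y by (intro sum.cong) auto
      also have "\<dots> = (case f j of None \<Rightarrow> 0 | Some k \<Rightarrow> 1)"
        by (rule sum_indicator_option) (use fj[OF that] in auto)
      finally show ?thesis by (simp split: option.splits)
    qed
    show ?A
      using f row y col by (auto simp: band_assignment_def band_choices_iff)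
    have "(\<Sum>k\<in>Kset D. dev D i j k * x j * real (y j k)) = gain D i x j (f j)" if "j \<in> Jset D" for j
    proof -
      have "(\<Sum>k\<in>Kset D. dev D i j k * x j * real (y j k)) =
          (\<Sum>k\<in>Kset D. dev D i j k * x j * of_bool (f j = Some k))"
        using that y by (intro sum.cong) auto
      also have "\<dots> = gain D i x j (f j)"
        unfolding gain_def by (rule sum_indicator_option) (use fj[OF that] in auto)
      finally show ?thesis .
    qed
    then show ?B by simp
  qed
  have decode: "\<exists>f \<in> Jset D \<rightarrow>\<^sub>E insert None (Some ` Kset D).
      \<forall>j\<in>Jset D. \<forall>k\<in>Kset D. y j k = of_bool (f j = Some k)" if y: "band_assignment D y" for y
  proof -
    have "\<exists>b\<in>insert None (Some ` Kset D). \<forall>k\<in>Kset D. y j k = of_bool (b = Some k)"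
      if j: "j \<in> Jset D" for j
    proof (cases "\<exists>k\<in>Kset D. y j k = 1")
      case False
      then show ?thesis using y j by (intro bexI[of _ None]) (auto simp: band_assignment_def)
    next
      case True
      then obtain k where k: "k \<in> Kset D" "y j k = 1" by blast
      \<comment> \<open>A second one in row \<open>j\<close> would make the row sum at least two.\<close>
      have "y j c = 0" if "c \<in> Kset D" "c \<noteq> k" for c
      proof -
        have "(\<Sum>c\<in>{k, c}. y j c) \<le> (\<Sum>c\<in>Kset D. y j c)"
          using that k by (intro sum_mono2) auto
        also have "\<dots> \<le> 1" using y j by (simp add: band_assignment_def)
        finally show ?thesis using that k by simp
      qed
      with k show ?thesis by (intro bexI[of _ "Some k"]) auto
    qed
    then obtain f where "\<And>j. j \<in> Jset D \<Longrightarrow> f j \<in> insert None (Some ` Kset D) \<and>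
        (\<forall>k\<in>Kset D. y j k = of_bool (f j = Some k))"
      by metis
    then show ?thesis by (intro bexI[of _ "restrict f (Jset D)"]) auto
  qed
  have "{?val y | y. band_assignment D y} \<subseteq> ?R"
  proof safe
    fix y assume y: "band_assignment D y"
    from decode[OF y] obtain f where f: "f \<in> Jset D \<rightarrow>\<^sub>E insert None (Some ` Kset D)"
        and fy: "\<And>j k. j \<in> Jset D \<Longrightarrow> k \<in> Kset D \<Longrightarrow> y j k = of_bool (f j = Some k)"
      by blast
    have "f \<in> band_choices D" "?val y = (\<Sum>j\<in>Jset D. gain D i x j (f j))"
      using encode[OF f, of y] val[OF f, of y] fy y by simp_all
    then show "?val y \<in> ?R" by (intro image_eqI)
  qed
  moreover have "?R \<subseteq> {?val y | y. band_assignment D y}"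
  proof (rule image_subsetI)
    fix f assume f: "f \<in> band_choices D"
    then have f': "f \<in> Jset D \<rightarrow>\<^sub>E insert None (Some ` Kset D)"
      by (simp add: band_choices_iff)
    let ?y = "\<lambda>j k. of_bool (f j = Some k) :: nat"
    have "band_assignment D ?y" "?val ?y = (\<Sum>j\<in>Jset D. gain D i x j (f j))"
      using encode[OF f', of ?y] val[OF f', of ?y] f by simp_all
    then show "(\<Sum>j\<in>Jset D. gain D i x j (f j)) \<in> {?val y | y. band_assignment D y}"
      by (intro CollectI exI[of _ ?y]) simp
  qed
  ultimately show ?thesis by (rule equalityI)
qed

lemma DEV_eq_Max:
  "DEV D i x = Max ((\<lambda>f. \<Sum>j\<in>Jset D. gain D i x j (f j)) ` band_choices D)"
  by (simp only: DEV_def assignment_values)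

section \<open>Duality for the maximum deviation\<close>

lemma sum_by_class:
  fixes c :: "'k \<Rightarrow> real"
  assumes "finite J" "finite K" "f ` J \<subseteq> insert None (Some ` K)"
  shows "(\<Sum>j\<in>J. case f j of None \<Rightarrow> 0 | Some k \<Rightarrow> c k) = (\<Sum>k\<in>K. c k * real (card {j \<in> J. f j = Some k}))"
proof -
  have "(\<Sum>j\<in>J. case f j of None \<Rightarrow> 0 | Some k \<Rightarrow> c k) = (\<Sum>j\<in>J. \<Sum>k\<in>K. c k * of_bool (f j = Some k))"
    using assms by (intro sum.cong) (auto simp: sum_indicator_option image_subset_iff)
  also have "\<dots> = (\<Sum>k\<in>K. \<Sum>j\<in>J. c k * of_bool (f j = Some k))"
    by (rule sum.swap)
  also have "\<dots> = (\<Sum>k\<in>K. c k * real (card {j \<in> J. f j = Some k}))"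
    using assms(1) by (intro sum.cong) (auto simp: of_bool_def sum.If_cases Int_def simp flip: sum_distrib_left)
  finally show ?thesis .
qed

definition dual_feasible ::
  "multiband \<Rightarrow> nat \<Rightarrow> (nat \<Rightarrow> real) \<Rightarrow> (int \<Rightarrow> real) \<Rightarrow> (int \<Rightarrow> real) \<Rightarrow> (nat \<Rightarrow> real) \<Rightarrow> bool" where
  "dual_feasible D i x v w z \<longleftrightarrow>
     (\<forall>j\<in>Jset D. \<forall>k\<in>Kset D. - v k + w k + z j \<ge> dev D i j k * x j) \<and>
     (\<forall>k\<in>Kset D. v k \<ge> 0 \<and> w k \<ge> 0) \<and> (\<forall>j\<in>Jset D. z j \<ge> 0)"

definition dual_value :: "multiband \<Rightarrow> (int \<Rightarrow> real) \<Rightarrow> (int \<Rightarrow> real) \<Rightarrow> (nat \<Rightarrow> real) \<Rightarrow> real" where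
  "dual_value D v w z =
     - (\<Sum>k\<in>Kset D. real (lo D k) * v k) + (\<Sum>k\<in>Kset D. real (up D k) * w k) + (\<Sum>j\<in>Jset D. z j)"

text \<open>
  Weak duality: each column gains at most \<open>z j\<close> plus \<open>w k - v k\<close> for the band \<open>k\<close> it is in, and
  summing the latter over the columns weights it with the class size, which lies between the bounds.
\<close>

lemma DEV_le_dual_value:
  assumes "valid_multiband D" "dual_feasible D i x v w z"
  shows "DEV D i x \<le> dual_value D v w z"
proof -
  have "(\<Sum>j\<in>Jset D. gain D i x j (f j)) \<le> dual_value D v w z" if f: "f \<in> band_choices D" for f
  proof -
    let ?n = "\<lambda>k. card {j \<in> Jset D. f j = Some k}"
    have f': "f ` Jset D \<subseteq> insert None (Some ` Kset D)"
      using f by (auto simp: band_choices_iff)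
    have "gain D i x j (f j) \<le> (case f j of None \<Rightarrow> 0 | Some k \<Rightarrow> - v k + w k) + z j"
      if "j \<in> Jset D" for j
      using assms(2) f' that by (force simp: gain_def dual_feasible_def image_subset_iff split: option.splits)
    then have "(\<Sum>j\<in>Jset D. gain D i x j (f j)) \<le>
        (\<Sum>j\<in>Jset D. (case f j of None \<Rightarrow> 0 | Some k \<Rightarrow> - v k + w k) + z j)"
      by (rule sum_mono)
    also have "\<dots> = (\<Sum>k\<in>Kset D. (- v k + w k) * real (?n k)) + (\<Sum>j\<in>Jset D. z j)"
      using f' by (subst sum.distrib, subst sum_by_class) auto
    also have "(\<Sum>k\<in>Kset D. (- v k + w k) * real (?n k)) \<le>
        (\<Sum>k\<in>Kset D. - (real (lo D k) * v k) + real (up D k) * w k)"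
    proof (rule sum_mono)
      fix k assume k: "k \<in> Kset D"
      have "real (lo D k) * v k \<le> real (?n k) * v k" "real (?n k) * w k \<le> real (up D k) * w k"
        using f assms(2) k by (auto simp: band_choices_iff dual_feasible_def intro!: mult_right_mono)
      then show "(- v k + w k) * real (?n k) \<le> - (real (lo D k) * v k) + real (up D k) * w k"
        by (simp add: algebra_simps)
    qed
    finally show ?thesis by (simp add: dual_value_def sum_subtractf)
  qed
  then show ?thesis
    unfolding DEV_eq_Max using finite_band_choices band_choices_nonempty[OF assms(1)] by simp
qed

text \<open>
  The prices of an optimal assignment give the dual solution. The objective values agree because a class
  of positive price has exactly \<open>up D k\<close> members, one of negative price exactly \<open>lo D k\<close>, and one of
  price zero contributes nothing on either side.
\<close>

lemma DEV_dual_attained: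
  assumes "valid_multiband D"
  shows "\<exists>v w z. dual_feasible D i x v w z \<and> dual_value D v w z = DEV D i x"
proof -
  let ?val = "\<lambda>f. \<Sum>j\<in>Jset D. gain D i x j (f j)"
  let ?l = "case_option 0 (lo D)" and ?u = "case_option (Suc (num_cols D)) (up D)"
  let ?B = "insert None (Some ` Kset D)"
  have "DEV D i x \<in> ?val ` band_choices D"
    unfolding DEV_eq_Max
    using finite_band_choices band_choices_nonempty[OF assms] by (intro Max_in) auto
  then obtain f where f: "f \<in> band_choices D" and DEV: "DEV D i x = ?val f" by blast
  have opt: "?val g \<le> ?val f" if "g \<in> band_choices D" for g
    using that finite_band_choices unfolding DEV[symmetric] DEV_eq_Max by simp
  let ?n = "\<lambda>b. card {j \<in> Jset D. f j = b}"
  have "\<exists>\<rho>. (\<forall>j\<in>Jset D. \<forall>b\<in>?B. gain D i x j b - \<rho> b \<le> gain D i x j (f j) - \<rho> (f j)) \<and>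
      (\<forall>b\<in>?B. (\<rho> b > 0 \<longrightarrow> ?n b = ?u b) \<and> (\<rho> b < 0 \<longrightarrow> ?n b = ?l b))"
    using f opt unfolding band_choices_def by (intro ex_prices) auto
  then obtain \<rho> where
      best: "\<And>j b. j \<in> Jset D \<Longrightarrow> b \<in> ?B \<Longrightarrow> gain D i x j b - \<rho> b \<le> gain D i x j (f j) - \<rho> (f j)"
      and pos: "\<And>b. b \<in> ?B \<Longrightarrow> \<rho> b > 0 \<Longrightarrow> ?n b = ?u b"
      and neg: "\<And>b. b \<in> ?B \<Longrightarrow> \<rho> b < 0 \<Longrightarrow> ?n b = ?l b"
    by blast
  define v where "v k = max 0 (- \<rho> (Some k))" for k
  define w where "w k = max 0 (\<rho> (Some k))" for k
  define z where "z j = gain D i x j (f j) - \<rho> (f j)" for j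
  have None: "\<rho> None \<le> 0"
    using pos[of None] card_filter_Jset_le[of D "\<lambda>j. f j = None"] by fastforce
  have f': "f ` Jset D \<subseteq> ?B"
    using f by (auto simp: band_choices_iff)
  have "dual_feasible D i x v w z"
    unfolding dual_feasible_def
  proof (intro conjI ballI)
    fix j assume j: "j \<in> Jset D"
    show "0 \<le> z j" using best[OF j, of None] None by (simp add: z_def gain_def)
    fix k assume "k \<in> Kset D"
    then show "dev D i j k * x j \<le> - v k + w k + z j"
      using best[OF j, of "Some k"] by (simp add: z_def v_def w_def gain_def)
  qed (simp_all add: v_def w_def)
  moreover have "dual_value D v w z = DEV D i x"
  proof -
    \<comment> \<open>The price of \<open>None\<close> is at most zero, and its class is empty if the price is negative, so the
      columns in it contribute zero.\<close>
    have "\<rho> (f j) = (case f j of None \<Rightarrow> 0 | Some k \<Rightarrow> \<rho> (Some k))" if "j \<in> Jset D" for j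
    proof (cases "f j")
      case None
      then have "?n None \<noteq> 0" using that by auto
      then show ?thesis using None neg[of None] \<open>\<rho> None \<le> 0\<close> by fastforce
    qed simp
    then have "(\<Sum>j\<in>Jset D. \<rho> (f j)) = (\<Sum>j\<in>Jset D. case f j of None \<Rightarrow> 0 | Some k \<Rightarrow> \<rho> (Some k))"
      by (intro sum.cong) auto
    also have "\<dots> = (\<Sum>k\<in>Kset D. \<rho> (Some k) * real (?n (Some k)))"
      using f' by (intro sum_by_class) auto
    also have "\<dots> = (\<Sum>k\<in>Kset D. - (real (lo D k) * v k) + real (up D k) * w k)"
    proof (rule sum.cong)
      fix k assume k: "k \<in> Kset D"
      show "\<rho> (Some k) * real (?n (Some k)) = - (real (lo D k) * v k) + real (up D k) * w k"
        using pos[of "Some k"] neg[of "Some k"] k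
        by (cases "\<rho> (Some k)" "0::real" rule: linorder_cases) (auto simp: v_def w_def)
    qed simp
    finally show ?thesis
      unfolding DEV dual_value_def z_def by (simp add: sum_subtractf sum.distrib sum_negf)
  qed
  ultimately show ?thesis by blast
qed

section \<open>Equivalence and size of (RLP)\<close>

lemma rlp_feasible_iff_dual:
  "lp_feasible (rlp D) (rlp_point x v w z) \<longleftrightarrow>
     (\<forall>i\<in>Iset D. dual_feasible D i x (v i) (w i) (z i) \<and>
        (\<Sum>j\<in>Jset D. abar D i j * x j) + dual_value D (v i) (w i) (z i) \<le> rhs D i) \<and>
     (\<forall>j\<in>Jset D. x j \<ge> 0)"
  unfolding rlp_feasible_iff dual_feasible_def dual_value_def by (auto simp: algebra_simps)

lemma rc_feasible_iff_rlp:
  assumes "valid_multiband D"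
  shows "rc_feasible D x \<longleftrightarrow> (\<exists>v w z. lp_feasible (rlp D) (rlp_point x v w z))"
proof
  assume rc: "rc_feasible D x"
  have "\<forall>i. \<exists>v w z. dual_feasible D i x v w z \<and> dual_value D v w z = DEV D i x"
    using DEV_dual_attained[OF assms] by blast
  then obtain v w z where "\<And>i. dual_feasible D i x (v i) (w i) (z i)"
      "\<And>i. dual_value D (v i) (w i) (z i) = DEV D i x"
    by metis
  then have "lp_feasible (rlp D) (rlp_point x v w z)"
    using rc by (simp add: rlp_feasible_iff_dual rc_feasible_def)
  then show "\<exists>v w z. lp_feasible (rlp D) (rlp_point x v w z)" by blast
next
  assume "\<exists>v w z. lp_feasible (rlp D) (rlp_point x v w z)"
  then show "rc_feasible D x"
    unfolding rlp_feasible_iff_dual rc_feasible_def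
    using DEV_le_dual_value[OF assms] by (smt (verit))
qed

text \<open>Each constructor contributes an injective image of a product of index sets, so that the
  cardinalities can be read off.\<close>

lemma rlp_cons_image:
  "rlp_cons D =
     (Row ` Iset D \<union> case_prod (\<lambda>i. case_prod (Band i)) ` (Iset D \<times> Jset D \<times> Kset D)) \<union>
     (case_prod NonnegV ` (Iset D \<times> Kset D) \<union> case_prod NonnegW ` (Iset D \<times> Kset D)) \<union>
     (case_prod NonnegZ ` (Iset D \<times> Jset D) \<union> NonnegX ` Jset D)"  (is "_ = ?R")
proof (rule set_eqI)
  show "r \<in> rlp_cons D \<longleftrightarrow> r \<in> ?R" for r
    by (cases r) (auto simp: rlp_cons_def image_iff Bex_def)
qed

lemma card_rlp_vars:
  "card (rlp_vars D) = num_cols D + 2 * num_rows D * card (Kset D) + num_rows D * num_cols D"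
proof -
  have "real (card (rlp_vars D)) =
      real (num_cols D + 2 * num_rows D * card (Kset D) + num_rows D * num_cols D)"
    using sum_rlp_vars[of "\<lambda>_. 1" D] by (simp add: Iset_def)
  then show ?thesis by (simp only: of_nat_eq_iff)
qed

lemma finite_rlp_cons: "finite (rlp_cons D)"
  by (simp add: rlp_cons_image)

lemma card_rlp_cons:
  "card (rlp_cons D) = num_rows D + num_rows D * num_cols D * card (Kset D) +
     2 * num_rows D * card (Kset D) + num_rows D * num_cols D + num_cols D"
proof -
  have inj: "inj_on Row (Iset D)"
    "inj_on (case_prod (\<lambda>i. case_prod (Band i))) (Iset D \<times> Jset D \<times> Kset D)"
    "inj_on (case_prod NonnegV) (Iset D \<times> Kset D)" "inj_on (case_prod NonnegW) (Iset D \<times> Kset D)"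
    "inj_on (case_prod NonnegZ) (Iset D \<times> Jset D)" "inj_on NonnegX (Jset D)"
    by (auto simp: inj_on_def)
  have "card (Iset D) = num_rows D" by (simp add: Iset_def)
  then show ?thesis
    unfolding rlp_cons_image
    by (subst card_Un_disjoint; (auto; fail)?)+ (simp add: card_image inj card_cartesian_product)
qed

lemma polynomial3_vars: "polynomial3 (\<lambda>a b c. b + 2 * a * c + a * b)"
  unfolding polynomial3_def
  by (rule exI[of _ 1], rule exI[of _ "\<lambda>i j k. of_bool ((i, j, k) = (0, 1, 0)) +
        2 * of_bool ((i, j, k) = (1, 0, 1)) + of_bool ((i, j, k) = (1, 1, 0))"])
    simp

lemma polynomial3_cons: "polynomial3 (\<lambda>a b c. a + a * b * c + 2 * a * c + a * b + b)"
  unfolding polynomial3_def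
  by (rule exI[of _ 1], rule exI[of _ "\<lambda>i j k. of_bool ((i, j, k) = (1, 0, 0)) +
        of_bool ((i, j, k) = (1, 1, 1)) + 2 * of_bool ((i, j, k) = (1, 0, 1)) +
        of_bool ((i, j, k) = (1, 1, 0)) + of_bool ((i, j, k) = (0, 1, 0))"])
    simp

theorem theorem1:
  "(\<forall>D. valid_multiband D \<longrightarrow>
      (\<forall>x. rc_feasible D x \<longleftrightarrow> (\<exists>v w z. lp_feasible (rlp D) (rlp_point x v w z))) \<and>
      (\<forall>x v w z. lp_objective (rlp D) (rlp_point x v w z) = rc_objective D x)) \<and>
   (\<exists>p q. polynomial3 p \<and> polynomial3 q \<and>
      (\<forall>D. valid_multiband D \<longrightarrow>
         finite (lp_vars (rlp D)) \<and> finite (lp_cons (rlp D)) \<and>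
         card (lp_vars (rlp D)) = p (num_rows D) (num_cols D) (card (Kset D)) \<and>
         card (lp_cons (rlp D)) = q (num_rows D) (num_cols D) (card (Kset D))))"
proof (intro conjI allI impI)
  fix D x v w z
  show "lp_objective (rlp D) (rlp_point x v w z) = rc_objective D x"
    by (simp add: rlp_objective_eq rc_objective_def)
next
  have "lp_vars (rlp D) = rlp_vars D" "lp_cons (rlp D) = rlp_cons D" for D
    by (simp_all add: rlp_def)
  then show "\<exists>p q. polynomial3 p \<and> polynomial3 q \<and>
      (\<forall>D. valid_multiband D \<longrightarrow>
         finite (lp_vars (rlp D)) \<and> finite (lp_cons (rlp D)) \<and>
         card (lp_vars (rlp D)) = p (num_rows D) (num_cols D) (card (Kset D)) \<and>
         card (lp_cons (rlp D)) = q (num_rows D) (num_cols D) (card (Kset D)))"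
    using polynomial3_vars polynomial3_cons card_rlp_vars card_rlp_cons finite_rlp_cons
    by (intro exI[of _ "\<lambda>a b c. b + 2 * a * c + a * b"]
        exI[of _ "\<lambda>a b c. a + a * b * c + 2 * a * c + a * b + b"]) auto
qed (rule rc_feasible_iff_rlp)
end
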